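(* For $r=1,2$, let $G_r$ be a $k_r$-regular graph of order $n_r$ with adjacency eigenvalues $\lambda_{r,1}=k_r\ge\lambda_{r,2}\ge\cdots\ge\lambda_{r,n_r}$. Then the eigenvalues (with multiplicity) of the distance Seidel matrix of the join $G_1\vee G_2$ are: $3+2\lambda_{1,t}$ for $t=2,\dots,n_1$; $3+2\lambda_{2,t}$ for $t=2,\dots,n_2$; and $$\frac{-(3n_1+3n_2-2k_1-2k_2-6)\pm\sqrt{(3n_1-3n_2-2k_1+2k_2)^2+4n_1n_2}}{2}.$$
   Context: The join $G_1\vee G_2$ of vertex-disjoint graphs is obtained from $G_1\cup G_2$ by adding all edges between a vertex of $G_1$ and a vertex of $G_2$. For a connected graph $G$ with distance matrix $\mathcal{D}(G)$, the distance Seidel matrix is $\mathcal{D}^S(G)=J-I-2\mathcal{D}(G)$, $J$ the all-ones matrix. *)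

theory Defs
  imports
    "Graph_Theory.Pair_Digraph"
    "Graph_Theory.Shortest_Path"
    "Jordan_Normal_Form.Char_Poly"
begin

text \<open>
  A finite simple graph is a \<^locale>\<open>pair_graph\<close>: every edge \<open>{u, v}\<close> is represented by the
  two arcs \<open>(u, v)\<close> and \<open>(v, u)\<close>, so the out-degree of a vertex is its degree.
\<close>

definition regular_graph :: "nat \<Rightarrow> 'a pair_pre_digraph \<Rightarrow> bool" where
  "regular_graph k G \<longleftrightarrow> pair_graph G \<and> (\<forall>v \<in> pverts G. out_degree (with_proj G) v = k)"

definition graph_join ::
  "'a pair_pre_digraph \<Rightarrow> 'a pair_pre_digraph \<Rightarrow> 'a pair_pre_digraph" where
  "graph_join G H =
     \<lparr> pverts = pverts G \<union> pverts H,
       parcs = parcs G \<union> parcs H \<union> (pverts G \<times> pverts H) \<union> (pverts H \<times> pverts G) \<rparr>"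

text \<open>
  The number of edges of a shortest walk. Meaningful only if \<open>v\<close> is reachable from \<open>u\<close>;
  otherwise the library value is \<open>\<infinity>\<close>, which \<^const>\<open>real_of_ereal\<close> sends to \<open>0\<close>.
\<close>

definition graph_dist :: "'a pair_pre_digraph \<Rightarrow> 'a \<Rightarrow> 'a \<Rightarrow> real" where
  "graph_dist G u v = real_of_ereal (wf_digraph.\<mu> (with_proj G) (\<lambda>_. 1) u v)"

text \<open>
  Matrices indexed by vertices are taken with respect to an enumeration \<open>vs\<close> of the vertex set.
\<close>

definition vertex_enum :: "'a pair_pre_digraph \<Rightarrow> 'a list \<Rightarrow> bool" where
  "vertex_enum G vs \<longleftrightarrow> distinct vs \<and> set vs = pverts G"

definition adjacency_mat :: "'a pair_pre_digraph \<Rightarrow> 'a list \<Rightarrow> real mat" where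
  "adjacency_mat G vs = mat (length vs) (length vs)
     (\<lambda>(i, j). if (vs ! i, vs ! j) \<in> parcs G then 1 else 0)"

definition dist_mat :: "'a pair_pre_digraph \<Rightarrow> 'a list \<Rightarrow> real mat" where
  "dist_mat G vs = mat (length vs) (length vs) (\<lambda>(i, j). graph_dist G (vs ! i) (vs ! j))"

definition all_ones_mat :: "nat \<Rightarrow> real mat" where
  "all_ones_mat n = mat n n (\<lambda>_. 1)"

definition dist_seidel_mat :: "'a pair_pre_digraph \<Rightarrow> 'a list \<Rightarrow> real mat" where
  "dist_seidel_mat G vs =
     all_ones_mat (length vs) - 1\<^sub>m (length vs) - 2 \<cdot>\<^sub>m dist_mat G vs"

text \<open>
  The real eigenvalues, with algebraic multiplicity. For a real symmetric matrix these are all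
  the eigenvalues, and algebraic and geometric multiplicities agree.
\<close>

definition eigenvalue_mset :: "real mat \<Rightarrow> real multiset" where
  "eigenvalue_mset A = proots (char_poly A)"

end

theory Submission
  imports Defs "HOL-Combinatorics.Permutations"
begin

text \<open>
  In a join all distances are 0, 1 or 2, so listing \<open>V(G\<^sub>1)\<close> before \<open>V(G\<^sub>2)\<close> the distance Seidel
  matrix is \<open>diag(3I + 2A\<^sub>1, 3I + 2A\<^sub>2) + UR\<close>, where the two columns of \<open>U\<close> are the indicator vectors
  of the parts and \<open>UR\<close> has entries \<open>-3\<close> inside the parts and \<open>-1\<close> between them. Regularity makes
  the columns of \<open>U\<close> eigenvectors of the block diagonal matrix, so the identity
  \<open>det(C - UR) det L = det C det(L - RU)\<close>, valid whenever \<open>CU = UL\<close>, shows that passing to the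
  join merely replaces the two eigenvalues \<open>3 + 2k\<^sub>r\<close> by the eigenvalues of a \<open>2 \<times> 2\<close> quotient
  matrix. Finally \<open>\<lambda>\<^sub>r\<^sub>,\<^sub>1 = k\<^sub>r\<close>, because no eigenvalue of a nonnegative matrix exceeds
  its constant row sum.
\<close>

section \<open>Polynomials with all their roots in the field\<close>

text \<open>The size hypothesis forces a root while the degree is positive. Dividing by its linear
  factor lowers the degree and the number of roots by one each, so the quotient inherits the
  hypothesis.\<close>

lemma prod_linear_factors_proots:
  fixes p :: "'a :: field poly"
  assumes "size (proots p) = degree p"
  shows "p = Polynomial.smult (lead_coeff p) (\<Prod>a\<in>#proots p. [:- a, 1:])"
  using assms
proof (induction "degree p" arbitrary: p)
  case 0
  then show ?case by (auto elim: degree_eq_zeroE)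
next
  case (Suc n)
  then have "p \<noteq> 0" and "proots p \<noteq> {#}" by auto
  then obtain a where "poly p a = 0"
    using set_count_proots[of p] by (metis (mono_tags) mem_Collect_eq multiset_nonemptyE)
  then obtain q where q: "p = [:- a, 1:] * q"
    by (auto simp: poly_eq_0_iff_dvd)
  with \<open>p \<noteq> 0\<close> have "q \<noteq> 0" by auto
  have pr: "proots p = add_mset a (proots q)"
    unfolding q using \<open>q \<noteq> 0\<close> by (subst proots_mult) auto
  have deg: "degree p = Suc (degree q)"
    unfolding q using \<open>q \<noteq> 0\<close> by (subst degree_mult_eq) auto
  have "q = Polynomial.smult (lead_coeff q) (\<Prod>a\<in>#proots q. [:- a, 1:])"
    using Suc.hyps(1)[of q] Suc.hyps(2) Suc.prems pr deg by simp
  moreover have "lead_coeff p = lead_coeff q"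
    unfolding q by (simp only: lead_coeff_mult) simp
  ultimately show ?case
    by (metis (no_types, lifting) mult_smult_right q pr image_mset_add_mset prod_mset.add_mset)
qed

text \<open>Splitting comes from counting: the assumed list of eigenvalues has \<open>n\<close>
  entries, and \<open>n\<close> is the degree of the characteristic polynomial, which is
  monic.\<close>

lemma char_poly_eq_prod:
  assumes A: "A \<in> carrier_mat n n" and "finite I" and "card I = n"
    and ev: "eigenvalue_mset A = image_mset lam (mset_set I)"
  shows "char_poly A = (\<Prod>i\<in>I. [:- lam i, 1:])"
proof -
  have "size (proots (char_poly A)) = degree (char_poly A)" and "lead_coeff (char_poly A) = 1"
    using ev degree_monic_char_poly[OF A] assms(2,3) by (auto simp: eigenvalue_mset_def)
  then have "char_poly A = (\<Prod>a\<in>#proots (char_poly A). [:- a, 1:])"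
    using prod_linear_factors_proots[of "char_poly A"] by simp
  also have "\<dots> = (\<Prod>i\<in>I. [:- lam i, 1:])"
    using ev by (simp add: eigenvalue_mset_def prod_unfold_prod_mset multiset.map_comp comp_def)
  finally show ?thesis .
qed

section \<open>Determinant identities\<close>

lemma det_2x2:
  fixes A :: "'a :: comm_ring_1 mat"
  assumes "A \<in> carrier_mat 2 2"
  shows "det A = A $$ (0, 0) * A $$ (1, 1) - A $$ (0, 1) * A $$ (1, 0)"
proof -
  have c: "cofactor A i 0 = (- 1) ^ i * A $$ (1 - i, 1)" if "i < 2" for i
  proof -
    have "mat_delete A i 0 \<in> carrier_mat 1 1"
      using assms by (auto simp: mat_delete_def)
    then show ?thesis
      using assms that less_2_cases[OF that] by (auto simp: cofactor_def det_single mat_delete_def)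
  qed
  show ?thesis
    using laplace_expansion_column[OF assms, of 0] c[of 0] c[of 1]
    by (simp add: numeral_2_eq_2 algebra_simps)
qed

text \<open>Makes the order of the vertices irrelevant: a reordering permutes rows and columns
  alike, and the two signs cancel.\<close>

lemma det_reindex:
  assumes "mset vs = mset ws"
  shows "det (mat (length vs) (length vs) (\<lambda>(i, j). f (vs ! i) (vs ! j))) =
    det (mat (length ws) (length ws) (\<lambda>(i, j). f (ws ! i) (ws ! j)))"
proof -
  obtain p where p: "p permutes {..<length ws}" and vs: "permute_list p ws = vs"
    using assms by (rule mset_eq_permutation)
  define n where "n = length ws"
  have len: "length vs = n" using vs by (auto simp: n_def)
  have p': "p permutes {0..<n}" using p by (simp add: n_def atLeast0LessThan)
  define B where "B = mat n n (\<lambda>(i, j). f (ws ! i) (ws ! j))"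
  define C where "C = mat n n (\<lambda>(i, j). B $$ (p i, j))"
  have carr: "B \<in> carrier_mat n n" "C \<in> carrier_mat n n" by (auto simp: B_def C_def)
  have lt: "p i < n" if "i < n" for i
    using permutes_in_image[OF p'] that by auto
  \<comment> \<open>The rows are already permuted in \<open>C\<close>; its columns are permuted as
    rows of its transpose.\<close>
  have "det (mat n n (\<lambda>(i, j). f (vs ! i) (vs ! j))) = det (transpose_mat (mat n n (\<lambda>(i, j). transpose_mat C $$ (p i, j))))"
    by (rule arg_cong[of _ _ det], rule eq_matI)
       (use lt in \<open>auto simp: B_def C_def vs[symmetric] permute_list_nth[OF p] n_def\<close>)
  also have "\<dots> = signof p * det (transpose_mat C)"
    by (subst det_transpose[of _ n]) (auto simp: det_permute_rows[OF _ p'] carr)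
  also have "\<dots> = signof p * (signof p * det B)"
    by (simp only: det_transpose[OF carr(2)]) (simp add: C_def det_permute_rows[OF carr(1) p'])
  also have "\<dots> = det B"
    by (cases p rule: sign_cases) auto
  finally show ?thesis by (simp add: len B_def n_def)
qed

text \<open>A division-free matrix determinant lemma: both sides equal
  \<open>det ?P * det L\<close>, by two block eliminations from the right. No inverse is formed, so
  singular \<open>C\<close> and \<open>L\<close> are covered.\<close>

lemma det_rank_update:
  fixes C :: "'a :: idom mat"
  assumes C: "C \<in> carrier_mat n n" and U: "U \<in> carrier_mat n m"
    and R: "R \<in> carrier_mat m n" and L: "L \<in> carrier_mat m m"
    and CU: "C * U = U * L"
  shows "det (C - U * R) * det L = det C * det (L - R * U)"
proof -
  let ?P = "four_block_mat C U R (1\<^sub>m m)"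
  let ?X = "four_block_mat (1\<^sub>m n) (0\<^sub>m n m) (- R) (1\<^sub>m m)"
  let ?Y = "four_block_mat (1\<^sub>m n) (- U) (0\<^sub>m m n) L"
  have P: "?P \<in> carrier_mat (n + m) (n + m)" using C R U by auto
  have "?P * ?X = four_block_mat (C - U * R) U (0\<^sub>m m n) (1\<^sub>m m)"
    by (subst mult_four_block_mat[of _ n n _ m _ m], use C U R in auto)
  moreover have "det ?X = 1"
    by (subst det_four_block_mat_upper_right_zero[of _ n _ m], use R in auto)
  moreover have "det (four_block_mat (C - U * R) U (0\<^sub>m m n) (1\<^sub>m m)) = det (C - U * R)"
    by (subst det_four_block_mat_lower_left_zero[of _ n _ m], use C U R in auto)
  moreover have "det (?P * ?X) = det ?P * det ?X"
    by (rule det_mult[OF P]) (use R in auto)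
  ultimately have 1: "det ?P = det (C - U * R)" by simp
  \<comment> \<open>The upper right block is \<open>C * (- U) + U * L\<close>, which vanishes by
    \<open>CU\<close>.\<close>
  have "?P * ?Y = four_block_mat C (0\<^sub>m n m) R (L - R * U)"
    by (subst mult_four_block_mat[of _ n n _ m _ m], use C U R L CU in auto)
  moreover have "det ?Y = det L"
    by (subst det_four_block_mat_lower_left_zero[of _ n _ m], use U L in auto)
  moreover have "det (four_block_mat C (0\<^sub>m n m) R (L - R * U)) = det C * det (L - R * U)"
    by (rule det_four_block_mat_upper_right_zero[of _ n _ m], use C U R L in auto)
  moreover have "det (?P * ?Y) = det ?P * det ?Y"
    by (rule det_mult[OF P]) (use U L in auto)
  ultimately show ?thesis using 1 by simp
qed

section \<open>Distances in a join\<close>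

text \<open>The distance is an infimum of \<open>ereal\<close> walk costs. With unit costs a walk of
  minimal length attains it, so it is finite and \<open>real_of_ereal\<close> returns the true
  value.\<close>

lemma graph_dist_eqI:
  assumes "wf_digraph (with_proj G)"
    and "pre_digraph.awalk (with_proj G) u p v"
    and "\<And>q. pre_digraph.awalk (with_proj G) u q v \<Longrightarrow> length p \<le> length q"
  shows "graph_dist G u v = length p"
proof -
  interpret wf_digraph "with_proj G" by fact
  have cost: "awalk_cost (\<lambda>_. 1) q = real (length q)" for q
    by (induction q) auto
  have "\<mu> (\<lambda>_. 1) u v = ereal (length p)"
  proof (rule antisym)
    show "\<mu> (\<lambda>_. 1) u v \<le> ereal (length p)"
      using min_cost_le_walk_cost[OF assms(2), of "\<lambda>_. 1"] by (simp add: cost)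
    show "ereal (length p) \<le> \<mu> (\<lambda>_. 1) u v"
      unfolding \<mu>_def using assms(3) by (intro INF_greatest) (auto simp: cost)
  qed
  then show ?thesis by (simp add: graph_dist_def)
qed

lemma graph_dist_join:
  assumes "pair_wf_digraph G" "pair_wf_digraph H" "pverts G \<noteq> {}" "pverts H \<noteq> {}"
    and uv: "u \<in> pverts G \<union> pverts H" "v \<in> pverts G \<union> pverts H"
  shows "graph_dist (graph_join G H) u v =
    (if u = v then 0 else if (u, v) \<in> parcs (graph_join G H) then 1 else 2)"
proof -
  interpret G: pair_wf_digraph G by fact
  interpret H: pair_wf_digraph H by fact
  let ?J = "graph_join G H"
  interpret J: pair_wf_digraph ?J
    by unfold_locales
       (auto simp: graph_join_def dest: G.arc_fst_in_verts G.arc_snd_in_verts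
          H.arc_fst_in_verts H.arc_snd_in_verts)
  have wf: "wf_digraph (with_proj ?J)" by unfold_locales
  have V: "pverts ?J = pverts G \<union> pverts H" by (simp add: graph_join_def)
  note walk = J.awalk_Nil_iff J.awalk_Cons_iff
  consider "u = v" | "u \<noteq> v" "(u, v) \<in> parcs ?J" | "u \<noteq> v" "(u, v) \<notin> parcs ?J" by blast
  then show ?thesis
  proof cases
    case 1
    then show ?thesis
      using graph_dist_eqI[OF wf, of u "[]" v] uv by (simp add: walk V)
  next
    case 2
    have "J.awalk u [(u, v)] v" using 2 uv by (simp add: walk V)
    moreover have "length [(u, v)] \<le> length q" if "J.awalk u q v" for q
      using that 2 by (cases q) (auto simp: walk)
    ultimately show ?thesis
      using graph_dist_eqI[OF wf, of u "[(u, v)]" v] 2 by simp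
  next
    case 3
    \<comment> \<open>All pairs across the parts are arcs, so \<open>u\<close> and \<open>v\<close>
      lie in the same part, and any vertex of the other part is a common neighbour.\<close>
    then obtain w where w: "(u, w) \<in> parcs ?J" "(w, v) \<in> parcs ?J"
      using uv assms(3,4) by (auto simp: graph_join_def)
    have "J.awalk u [(u, w), (w, v)] v" using w uv by (simp add: walk V)
    \<comment> \<open>A shorter walk would be empty or a single arc, and this case excludes
      both.\<close>
    moreover have "length [(u, w), (w, v)] \<le> length q" if "J.awalk u q v" for q
    proof (cases q)
      case Nil
      then show ?thesis using that 3 by (simp add: walk)
    next
      case (Cons a r)
      then show ?thesis using that 3 by (cases r) (auto simp: walk)
    qed
    ultimately show ?thesis
      using graph_dist_eqI[OF wf, of u "[(u, w), (w, v)]" v] 3 by simp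
  qed
qed

section \<open>The largest eigenvalue of a regular graph\<close>

text \<open>Compare both sides of the eigenvector equation in a coordinate \<open>i\<close> of
  largest modulus \<open>m\<close>: this gives \<open>\<bar>e\<bar> * m \<le> k * m\<close>, and
  \<open>m\<close> is positive because the eigenvector is nonzero.\<close>

lemma eigenvalue_le_row_sum:
  fixes A :: "real mat"
  assumes A: "A \<in> carrier_mat n n"
    and nonneg: "\<And>i j. i < n \<Longrightarrow> j < n \<Longrightarrow> 0 \<le> A $$ (i, j)"
    and rows: "\<And>i. i < n \<Longrightarrow> (\<Sum>j<n. A $$ (i, j)) = k"
    and e: "eigenvalue A e"
  shows "e \<le> k"
proof -
  obtain v where v: "v \<in> carrier_vec n" "v \<noteq> 0\<^sub>v n" "A *\<^sub>v v = e \<cdot>\<^sub>v v"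
    using e A by (auto simp: eigenvalue_def eigenvector_def)
  then obtain l where l: "l < n" "v $ l \<noteq> 0" by force
  define m where "m = Max ((\<lambda>j. \<bar>v $ j\<bar>) ` {..<n})"
  have le: "\<bar>v $ j\<bar> \<le> m" if "j < n" for j
    unfolding m_def using that by (intro Max_ge) auto
  have "m \<in> (\<lambda>j. \<bar>v $ j\<bar>) ` {..<n}"
    unfolding m_def using l by (intro Max_in) auto
  then obtain i where i: "i < n" "m = \<bar>v $ i\<bar>" by auto
  have "0 < m" using le[OF l(1)] l(2) by linarith
  have "e * v $ i = (\<Sum>j<n. A $$ (i, j) * v $ j)"
    using arg_cong[OF v(3), of "\<lambda>w. w $ i"] i(1) v(1) A
    by (simp add: scalar_prod_def atLeast0LessThan)
  then have "\<bar>e\<bar> * m \<le> (\<Sum>j<n. \<bar>A $$ (i, j) * v $ j\<bar>)"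
    by (metis abs_mult i(2) sum_abs)
  also have "\<dots> \<le> (\<Sum>j<n. A $$ (i, j) * m)"
    using nonneg i(1) le by (intro sum_mono) (auto simp: abs_mult intro!: mult_left_mono)
  also have "\<dots> = k * m" by (simp add: rows[OF i(1)] flip: sum_distrib_right)
  finally show ?thesis using \<open>0 < m\<close> by simp
qed

lemma eigenvalue_row_sum:
  fixes A :: "real mat"
  assumes A: "A \<in> carrier_mat n n" and "n \<noteq> 0"
    and rows: "\<And>i. i < n \<Longrightarrow> (\<Sum>j<n. A $$ (i, j)) = k"
  shows "eigenvalue A k"
  unfolding eigenvalue_def eigenvector_def
proof (intro exI conjI)
  show "vec n (\<lambda>_. 1) \<in> carrier_vec (dim_row A)" using A by auto
  show "vec n (\<lambda>_. 1 :: real) \<noteq> 0\<^sub>v (dim_row A)"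
  proof
    assume "vec n (\<lambda>_. 1 :: real) = 0\<^sub>v (dim_row A)"
    from arg_cong[OF this, of "\<lambda>v. v $ 0"] show False using A \<open>n \<noteq> 0\<close> by simp
  qed
  show "A *\<^sub>v vec n (\<lambda>_. 1) = k \<cdot>\<^sub>v vec n (\<lambda>_. 1)"
    by (rule eq_vecI) (use A rows in \<open>auto simp: scalar_prod_def atLeast0LessThan\<close>)
qed

lemma adjacency_row_sum:
  assumes "regular_graph k G" "vertex_enum G vs" "i < length vs"
  shows "(\<Sum>j<length vs. adjacency_mat G vs $$ (i, j)) = k"
proof -
  interpret pair_graph G using assms(1) by (simp add: regular_graph_def)
  have vs: "distinct vs" "set vs = pverts G" using assms(2) by (auto simp: vertex_enum_def)
  have v: "vs ! i \<in> pverts G" using vs(2) assms(3) by force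
  have "(\<Sum>j<length vs. adjacency_mat G vs $$ (i, j)) =
      (\<Sum>j<length vs. of_bool ((vs ! i, vs ! j) \<in> parcs G))"
    using assms(3) by (intro sum.cong) (auto simp: adjacency_mat_def)
  also have "\<dots> = (\<Sum>w\<in>pverts G. of_bool ((vs ! i, w) \<in> parcs G))"
    by (rule sum.reindex_bij_betw) (use vs in \<open>auto intro: bij_betw_nth\<close>)
  also have "\<dots> = card {w \<in> pverts G. (vs ! i, w) \<in> parcs G}"
    by (simp add: sum_of_bool_eq pair_finite_verts Int_def)
  \<comment> \<open>\<open>out_degree\<close> counts arcs, not neighbours; once the tail is fixed,
    an arc is determined by its head.\<close>
  also have "card {w \<in> pverts G. (vs ! i, w) \<in> parcs G} = card (out_arcs (with_proj G) (vs ! i))"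
    by (rule bij_betw_same_card[of "Pair (vs ! i)"])
       (auto simp: bij_betw_def inj_on_def out_arcs_def dest: in_arcsD2)
  also have "\<dots> = k"
    using assms(1) v by (simp add: regular_graph_def out_degree_def)
  finally show ?thesis .
qed


text \<open>Identifies the entry that the spectrum of the join omits: \<open>k\<close> occurs
  somewhere in the list, no entry exceeds it, and the list is decreasing.\<close>

lemma regular_lambda_1:
  assumes G: "regular_graph k G" and vs: "vertex_enum G vs" and n: "card (pverts G) = n" "n \<ge> 1"
    and ev: "eigenvalue_mset (adjacency_mat G vs) = image_mset lam (mset_set {1..n})"
    and anti: "antimono_on {1..n} lam"
  shows "lam 1 = real k"
proof (rule antisym)
  let ?A = "adjacency_mat G vs"
  have len: "length vs = n"
    using vs n by (metis distinct_card vertex_enum_def)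
  have A: "?A \<in> carrier_mat n n" by (simp add: adjacency_mat_def len)
  have rows: "(\<Sum>j<n. ?A $$ (i, j)) = real k" if "i < n" for i
    using adjacency_row_sum[OF G vs, of i] that by (simp add: len)
  \<comment> \<open>\<open>proots\<close> is empty for the zero polynomial, so its members are the
    roots only once this case is excluded.\<close>
  have "char_poly ?A \<noteq> 0" using degree_monic_char_poly[OF A] by auto
  then have eig: "eigenvalue ?A e \<longleftrightarrow> e \<in> lam ` {1..n}" for e
    using arg_cong[OF ev, of set_mset] eigenvalue_root_char_poly[OF A, of e]
    by (auto simp: eigenvalue_mset_def)
  show "lam 1 \<le> real k"
    by (rule eigenvalue_le_row_sum[OF A _ rows])
       (use n eig in \<open>auto simp: adjacency_mat_def len\<close>)
  obtain i where "i \<in> {1..n}" "lam i = real k"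
    using eigenvalue_row_sum[OF A _ rows] n eig by auto
  then show "real k \<le> lam 1"
    using monotone_onD[OF anti, of 1 i] n by auto
qed

section \<open>The characteristic polynomial of the join\<close>

text \<open>Constant row sums make the all-ones vector of each block an eigenvector, so
  \<open>det_rank_update\<close> applies with \<open>L\<close> diagonal. What remains is the
  determinant of the quotient matrix with rows \<open>(l1 + a * n1, b * n2)\<close> and
  \<open>(b * n1, l2 + a * n2)\<close>.\<close>

lemma det_join_block:
  fixes B1 B2 :: "real mat"
  assumes B: "B1 \<in> carrier_mat n1 n1" "B2 \<in> carrier_mat n2 n2"
    and rows1: "\<And>i. i < n1 \<Longrightarrow> (\<Sum>j<n1. B1 $$ (i, j)) = l1"
    and rows2: "\<And>i. i < n2 \<Longrightarrow> (\<Sum>j<n2. B2 $$ (i, j)) = l2"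
  shows "det (four_block_mat (B1 + mat n1 n1 (\<lambda>_. a)) (mat n1 n2 (\<lambda>_. b))
            (mat n2 n1 (\<lambda>_. b)) (B2 + mat n2 n2 (\<lambda>_. a))) * (l1 * l2) =
    det B1 * det B2 * ((l1 + a * n1) * (l2 + a * n2) - b\<^sup>2 * n1 * n2)"
proof -
  let ?c = "\<lambda>n. mat n 1 (\<lambda>_. 1) :: real mat"
  \<comment> \<open>Negated because \<open>det_rank_update\<close> subtracts
    \<open>U * R\<close>.\<close>
  let ?r = "\<lambda>n a. mat 1 n (\<lambda>_. - a) :: real mat"
  let ?s = "\<lambda>a. mat 1 1 (\<lambda>_. a) :: real mat"
  let ?C = "four_block_mat B1 (0\<^sub>m n1 n2) (0\<^sub>m n2 n1) B2"
  let ?U = "four_block_mat (?c n1) (0\<^sub>m n1 1) (0\<^sub>m n2 1) (?c n2)"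
  let ?R = "four_block_mat (?r n1 a) (?r n2 b) (?r n1 b) (?r n2 a)"
  let ?L = "four_block_mat (?s l1) (0\<^sub>m 1 1) (0\<^sub>m 1 1) (?s l2)"
  have U: "?U \<in> carrier_mat (n1 + n2) (1 + 1)" and R: "?R \<in> carrier_mat (1 + 1) (n1 + n2)"
    and C: "?C \<in> carrier_mat (n1 + n2) (n1 + n2)" and L: "?L \<in> carrier_mat (1 + 1) (1 + 1)"
    using B by auto
  have Bc: "B1 * ?c n1 = ?c n1 * ?s l1" "B2 * ?c n2 = ?c n2 * ?s l2"
    using B rows1 rows2 by (auto intro!: eq_matI simp: scalar_prod_def atLeast0LessThan)
  have "?C * ?U = four_block_mat (B1 * ?c n1) (0\<^sub>m n1 1) (0\<^sub>m n2 1) (B2 * ?c n2)"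
    by (subst mult_four_block_mat[of _ n1 n1 _ n2 _ n2], use B in auto)
  moreover have "?U * ?L = four_block_mat (?c n1 * ?s l1) (0\<^sub>m n1 1) (0\<^sub>m n2 1) (?c n2 * ?s l2)"
    by (subst mult_four_block_mat[of _ n1 1 _ 1 _ n2], auto)
  ultimately have CU: "?C * ?U = ?U * ?L" by (simp only: Bc)
  have cr: "?c n * ?r m a = mat n m (\<lambda>_. - a)" for n m a
    by (rule eq_matI) (auto simp: scalar_prod_def)
  have rc: "?r n a * ?c n = ?s (- a * n)" for n a
    by (rule eq_matI) (auto simp: scalar_prod_def)
  have UR: "?U * ?R = four_block_mat (mat n1 n1 (\<lambda>_. - a)) (mat n1 n2 (\<lambda>_. - b))
      (mat n2 n1 (\<lambda>_. - b)) (mat n2 n2 (\<lambda>_. - a))"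
    by (subst mult_four_block_mat[of _ n1 1 _ 1 _ n2], auto simp: cr simp del: One_nat_def)
  have RU: "?R * ?U = four_block_mat (?s (- a * n1)) (?s (- b * n2)) (?s (- b * n1)) (?s (- a * n2))"
    by (subst mult_four_block_mat[of _ 1 n1 _ n2 _ 1], auto simp: rc simp del: One_nat_def)
  have "?C - ?U * ?R = four_block_mat (B1 + mat n1 n1 (\<lambda>_. a)) (mat n1 n2 (\<lambda>_. b))
      (mat n2 n1 (\<lambda>_. b)) (B2 + mat n2 n2 (\<lambda>_. a))"
    unfolding UR by (rule eq_matI) (use B in auto)
  moreover have "det ?C = det B1 * det B2"
    by (rule det_four_block_mat_upper_right_zero) (use B in auto)
  moreover have "det ?L = l1 * l2"
    by (subst det_2x2) auto
  moreover have "det (?L - ?R * ?U) = (l1 + a * n1) * (l2 + a * n2) - b\<^sup>2 * n1 * n2"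
    unfolding RU by (subst det_2x2) (auto simp: power2_eq_square)
  ultimately show ?thesis
    using det_rank_update[OF C U R L CU] by simp
qed

text \<open>With \<open>y = (x - 3) / 2\<close> the matrix is
  \<open>2 (y I - A) = (x - 3) I - 2 A\<close>: the diagonal block of \<open>x I\<close> minus the
  distance Seidel matrix, with 3 subtracted from every entry. Absence of loops gives the
  diagonal.\<close>

lemma index_adjacency_pencil:
  fixes x :: real
  assumes "pair_loopfree_digraph G" "i < length vs" "j < length vs"
  shows "(2 \<cdot>\<^sub>m - char_matrix (adjacency_mat G vs) ((x - 3) / 2)) $$ (i, j) =
    (if i = j then x - 3 else if (vs ! i, vs ! j) \<in> parcs G then - 2 else 0)"
proof -
  interpret pair_loopfree_digraph G by fact
  show ?thesis
    using assms(2,3) pair_no_loops[of "(vs ! i, vs ! j)"]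
    by (auto simp: char_matrix_def adjacency_mat_def)
qed

text \<open>The factors \<open>x - 3 - 2 * real k1\<close> and \<open>x - 3 - 2 * real k2\<close>
  stay on the left, so the identity holds at every \<open>x\<close>, including their zeros.\<close>

lemma poly_char_poly_join:
  fixes x :: real
  assumes G1: "regular_graph k1 G1" and n1: "card (pverts G1) = n1" "n1 \<ge> 1"
    and G2: "regular_graph k2 G2" and n2: "card (pverts G2) = n2" "n2 \<ge> 1"
    and disj: "pverts G1 \<inter> pverts G2 = {}"
    and vs1: "vertex_enum G1 vs1" and vs2: "vertex_enum G2 vs2"
    and vs: "vertex_enum (graph_join G1 G2) vs"
  shows "poly (char_poly (dist_seidel_mat (graph_join G1 G2) vs)) x *
      ((x - 3 - 2 * real k1) * (x - 3 - 2 * real k2)) =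
    2 ^ n1 * poly (char_poly (adjacency_mat G1 vs1)) ((x - 3) / 2) *
    (2 ^ n2 * poly (char_poly (adjacency_mat G2 vs2)) ((x - 3) / 2)) *
    ((x - 3 - 2 * real k1 + 3 * real n1) * (x - 3 - 2 * real k2 + 3 * real n2) - real n1 * real n2)"
proof -
  let ?J = "graph_join G1 G2" and ?y = "(x - 3) / 2"
  let ?A1 = "adjacency_mat G1 vs1" and ?A2 = "adjacency_mat G2 vs2"
  interpret G1: pair_graph G1 using G1 by (simp add: regular_graph_def)
  interpret G2: pair_graph G2 using G2 by (simp add: regular_graph_def)
  have e1: "distinct vs1" "set vs1 = pverts G1" and e2: "distinct vs2" "set vs2 = pverts G2"
    and e: "distinct vs" "set vs = pverts G1 \<union> pverts G2"
    using vs1 vs2 vs by (auto simp: vertex_enum_def graph_join_def)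
  have len: "length vs1 = n1" "length vs2 = n2"
    using e1 e2 n1 n2 by (metis distinct_card)+
  have perm: "mset vs = mset (vs1 @ vs2)"
    using e e1 e2 disj by (subst set_eq_iff_mset_eq_distinct[symmetric]) auto
  then have lvs: "length vs = n1 + n2" using len by (metis length_append size_mset)
  have dist: "graph_dist ?J u v = (if u = v then 0 else if (u, v) \<in> parcs ?J then 1 else 2)"
    if "u \<in> set vs" "v \<in> set vs" for u v
    using that e n1 n2 by (intro graph_dist_join) (auto intro: G1.pair_wf_digraph G2.pair_wf_digraph)
  \<comment> \<open>The entries of \<open>x I\<close> minus the distance Seidel matrix: off the
    diagonal they are \<open>2 d - 1\<close>, where the distance \<open>d\<close> is 1 or 2. As a
    function of vertices, \<open>h\<close> fits \<open>det_reindex\<close>.\<close>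
  define h where "h u v = (if u = v then x else if (u, v) \<in> parcs ?J then 1 else 3)" for u v
  define B1 where "B1 = 2 \<cdot>\<^sub>m - char_matrix ?A1 ?y"
  define B2 where "B2 = 2 \<cdot>\<^sub>m - char_matrix ?A2 ?y"
  have A: "?A1 \<in> carrier_mat n1 n1" "?A2 \<in> carrier_mat n2 n2"
    by (auto simp: adjacency_mat_def len)
  then have B: "B1 \<in> carrier_mat n1 n1" "B2 \<in> carrier_mat n2 n2"
    by (auto simp: B1_def B2_def)
  \<comment> \<open>The powers of 2 come from scaling every row of the block.\<close>
  have detB: "det B1 = 2 ^ n1 * poly (char_poly ?A1) ?y" "det B2 = 2 ^ n2 * poly (char_poly ?A2) ?y"
    using A by (auto simp: B1_def B2_def char_poly_matrix char_matrix_def)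
  have row: "(\<Sum>j<n. (2 \<cdot>\<^sub>m - char_matrix M ?y) $$ (i, j)) = x - 3 - 2 * k"
    if "M \<in> carrier_mat n n" "i < n" "(\<Sum>j<n. M $$ (i, j)) = k" for M :: "real mat" and n i k
  proof -
    have "(\<Sum>j<n. (2 \<cdot>\<^sub>m - char_matrix M ?y) $$ (i, j)) =
        (\<Sum>j<n. (if j = i then x - 3 else 0) - 2 * M $$ (i, j))"
      using that by (intro sum.cong) (auto simp: char_matrix_def algebra_simps)
    also have "\<dots> = x - 3 - 2 * k"
      using that by (simp add: sum_subtractf flip: sum_distrib_left)
    finally show ?thesis .
  qed
  have rows1: "(\<Sum>j<n1. B1 $$ (i, j)) = x - 3 - 2 * real k1" if "i < n1" for i
    unfolding B1_def using row[OF A(1) that] adjacency_row_sum[OF G1 vs1, of i] that len by simp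
  have rows2: "(\<Sum>j<n2. B2 $$ (i, j)) = x - 3 - 2 * real k2" if "i < n2" for i
    unfolding B2_def using row[OF A(2) that] adjacency_row_sum[OF G2 vs2, of i] that len by simp
  have D: "dist_seidel_mat ?J vs \<in> carrier_mat (n1 + n2) (n1 + n2)"
    by (simp add: dist_seidel_mat_def dist_mat_def lvs carrier_matI)
  have "poly (char_poly (dist_seidel_mat ?J vs)) x = det (- char_matrix (dist_seidel_mat ?J vs) x)"
    by (rule char_poly_matrix[OF D])
  also have "- char_matrix (dist_seidel_mat ?J vs) x =
      mat (length vs) (length vs) (\<lambda>(i, j). h (vs ! i) (vs ! j))"
    by (rule eq_matI)
       (auto simp: char_matrix_def dist_seidel_mat_def dist_mat_def all_ones_mat_def h_def dist
         nth_eq_iff_index_eq[OF e(1)])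
  also have "det \<dots> = det (mat (length (vs1 @ vs2)) (length (vs1 @ vs2))
      (\<lambda>(i, j). h ((vs1 @ vs2) ! i) ((vs1 @ vs2) ! j)))"
    by (rule det_reindex[OF perm])
  also have "mat (length (vs1 @ vs2)) (length (vs1 @ vs2))
      (\<lambda>(i, j). h ((vs1 @ vs2) ! i) ((vs1 @ vs2) ! j)) =
    four_block_mat (B1 + mat n1 n1 (\<lambda>_. 3)) (mat n1 n2 (\<lambda>_. 1))
      (mat n2 n1 (\<lambda>_. 1)) (B2 + mat n2 n2 (\<lambda>_. 3))"
    (is "?H = ?F")
  proof (rule eq_matI)
    have v1: "vs1 ! i \<in> pverts G1" if "i < n1" for i using that e1 len by force
    have v2: "vs2 ! i \<in> pverts G2" if "i < n2" for i using that e2 len by force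
    \<comment> \<open>By disjointness, an arc of the join between two vertices of \<open>G1\<close>
      is an arc of \<open>G1\<close>.\<close>
    have h11: "h (vs1 ! i) (vs1 ! j) = B1 $$ (i, j) + 3" if "i < n1" "j < n1" for i j
      using that v1[of i] v1[of j] disj index_adjacency_pencil[OF G1.pair_loopfree_digraph_axioms, of i vs1 j x]
      by (auto simp: B1_def h_def len graph_join_def nth_eq_iff_index_eq[OF e1(1)] dest: G2.in_arcsD1)
    have h22: "h (vs2 ! i) (vs2 ! j) = B2 $$ (i, j) + 3" if "i < n2" "j < n2" for i j
      using that v2[of i] v2[of j] disj index_adjacency_pencil[OF G2.pair_loopfree_digraph_axioms, of i vs2 j x]
      by (auto simp: B2_def h_def len graph_join_def nth_eq_iff_index_eq[OF e2(1)] dest: G1.in_arcsD1)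
    have h12: "h (vs1 ! i) (vs2 ! j) = 1" "h (vs2 ! j) (vs1 ! i) = 1" if "i < n1" "j < n2" for i j
      using v1[OF that(1)] v2[OF that(2)] disj by (auto simp: h_def graph_join_def)
    fix i j
    assume "i < dim_row ?F" "j < dim_col ?F"
    then have ij: "i < n1 + n2" "j < n1 + n2" using B by auto
    then show "?H $$ (i, j) = ?F $$ (i, j)"
      using B by (auto simp: nth_append len h11 h22 h12)
  qed (use B len in auto)
  finally show ?thesis
    using det_join_block[OF B rows1 rows2, of 3 1] by (simp add: detB)
qed

section \<open>Comparison of roots\<close>

theorem theorem6p1:
  fixes G1 G2 :: "'a pair_pre_digraph"
    and k1 k2 n1 n2 :: nat
    and lam1 lam2 :: "nat \<Rightarrow> real"
    and vs1 vs2 vs :: "'a list"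
  assumes "regular_graph k1 G1" and "card (pverts G1) = n1" and "n1 \<ge> 1"
    and "regular_graph k2 G2" and "card (pverts G2) = n2" and "n2 \<ge> 1"
    and "pverts G1 \<inter> pverts G2 = {}"
    and "vertex_enum G1 vs1" and "vertex_enum G2 vs2"
    and "eigenvalue_mset (adjacency_mat G1 vs1) = image_mset lam1 (mset_set {1..n1})"
    and "antimono_on {1..n1} lam1"
    and "eigenvalue_mset (adjacency_mat G2 vs2) = image_mset lam2 (mset_set {1..n2})"
    and "antimono_on {1..n2} lam2"
    and "vertex_enum (graph_join G1 G2) vs"
  shows "eigenvalue_mset (dist_seidel_mat (graph_join G1 G2) vs) =
      image_mset (\<lambda>t. 3 + 2 * lam1 t) (mset_set {2..n1})
    + image_mset (\<lambda>t. 3 + 2 * lam2 t) (mset_set {2..n2})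
    + {# (- (3 * real n1 + 3 * real n2 - 2 * real k1 - 2 * real k2 - 6)
           + sqrt ((3 * real n1 - 3 * real n2 - 2 * real k1 + 2 * real k2)^2
                   + 4 * real n1 * real n2)) / 2,
         (- (3 * real n1 + 3 * real n2 - 2 * real k1 - 2 * real k2 - 6)
           - sqrt ((3 * real n1 - 3 * real n2 - 2 * real k1 + 2 * real k2)^2
                   + 4 * real n1 * real n2)) / 2 #}"
proof -
  let ?P = "char_poly (dist_seidel_mat (graph_join G1 G2) vs)"
  define s where "s = 3 * real n1 + 3 * real n2 - 2 * real k1 - 2 * real k2 - 6"
  define d where "d = (3 * real n1 - 3 * real n2 - 2 * real k1 + 2 * real k2)^2 + 4 * real n1 * real n2"
  let ?e1 = "(- s + sqrt d) / 2" and ?e2 = "(- s - sqrt d) / 2"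
  let ?M = "\<lambda>lam (n :: nat). \<Prod>i\<in>{1..n}. [:- (3 + 2 * lam i), 1:] :: real poly"
  have len: "length vs1 = n1" "length vs2 = n2"
    using assms by (auto simp: vertex_enum_def distinct_card[symmetric])
  have lam: "lam1 1 = k1" "lam2 1 = k2"
    using regular_lambda_1[OF assms(1,8,2,3,10,11)] regular_lambda_1[OF assms(4,9,5,6,12,13)] .
  have cp: "2 ^ n * poly (char_poly (adjacency_mat G vs)) ((x - 3) / 2) = poly (?M lam n) x"
    if "length vs = n" "eigenvalue_mset (adjacency_mat G vs) = image_mset lam (mset_set {1..n})"
    for G :: "'a pair_pre_digraph" and vs lam n and x :: real
  proof -
    have "adjacency_mat G vs \<in> carrier_mat n n" using that by (simp add: adjacency_mat_def)
    then have "char_poly (adjacency_mat G vs) = (\<Prod>i\<in>{1..n}. [:- lam i, 1:])"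
      using that by (intro char_poly_eq_prod) auto
    then have "2 ^ n * poly (char_poly (adjacency_mat G vs)) ((x - 3) / 2) =
        2 ^ n * (\<Prod>i\<in>{1..n}. (x - 3) / 2 - lam i)"
      by (simp add: poly_prod)
    also have "\<dots> = (\<Prod>i\<in>{1..n}. 2 * ((x - 3) / 2 - lam i))"
      by (simp only: prod.distrib prod_constant) simp
    also have "\<dots> = poly (?M lam n) x"
      unfolding poly_prod by (rule prod.cong) (auto simp: field_simps)
    finally show ?thesis .
  qed
  \<comment> \<open>The two linear factors have mean \<open>x + s / 2\<close> and difference
    \<open>3 n1 - 3 n2 - 2 k1 + 2 k2\<close>. Their product is the square of the mean minus a
    quarter of the squared difference, which explains \<open>d\<close>.\<close>
  have "0 \<le> d" by (simp add: d_def)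
  then have quad: "(x - 3 - 2 * real k1 + 3 * real n1) * (x - 3 - 2 * real k2 + 3 * real n2) - real n1 * real n2 =
      (x - ?e1) * (x - ?e2)" for x :: real
  proof -
    have "(x - ?e1) * (x - ?e2) = (x + s / 2)^2 - (sqrt d)^2 / 4"
      by (simp add: power2_eq_square field_simps)
    then show ?thesis
      using \<open>0 \<le> d\<close> by (simp add: s_def d_def power2_eq_square field_simps)
  qed
  have "poly (?P * ([:- (3 + 2 * real k1), 1:] * [:- (3 + 2 * real k2), 1:])) x =
      poly (?M lam1 n1 * ?M lam2 n2 * ([:- ?e1, 1:] * [:- ?e2, 1:])) x" for x
    using poly_char_poly_join[OF assms(1-9,14), of x]
    by (simp only: cp[OF len(1) assms(10)] cp[OF len(2) assms(12)] quad poly_mult)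
       (simp add: algebra_simps)
  \<comment> \<open>Agreement at all real points is equality of polynomials, so root multiplicities
    can be compared.\<close>
  then have "?P * ([:- (3 + 2 * real k1), 1:] * [:- (3 + 2 * real k2), 1:]) =
      ?M lam1 n1 * ?M lam2 n2 * ([:- ?e1, 1:] * [:- ?e2, 1:])"
    by (intro poly_eq_poly_eq_iff[THEN iffD1] ext)
  then have "proots (?P * ([:- (3 + 2 * real k1), 1:] * [:- (3 + 2 * real k2), 1:])) =
      proots (?M lam1 n1 * ?M lam2 n2 * ([:- ?e1, 1:] * [:- ?e2, 1:]))"
    by (rule arg_cong)
  moreover have "?P \<noteq> 0"
    using degree_monic_char_poly[of "dist_seidel_mat (graph_join G1 G2) vs" "length vs"]
    by (force simp: dist_seidel_mat_def dist_mat_def carrier_matI)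
  moreover have pM: "proots (?M lam n) = image_mset (\<lambda>t. 3 + 2 * lam t) (mset_set {1..n})" "?M lam n \<noteq> 0"
    for lam n
    by (simp_all add: proots_prod sum_unfold_sum_mset add.commute)
  ultimately have "proots ?P + {# 3 + 2 * real k1, 3 + 2 * real k2 #} =
      image_mset (\<lambda>t. 3 + 2 * lam1 t) (mset_set {1..n1}) +
      image_mset (\<lambda>t. 3 + 2 * lam2 t) (mset_set {1..n2}) + {# ?e1, ?e2 #}"
    by (simp add: proots_mult add.commute add_mset_commute del: mult_pCons_left mult_pCons_right)
  \<comment> \<open>Splitting off index 1 exposes \<open>3 + 2 * real k1\<close> and
    \<open>3 + 2 * real k2\<close> on the right, where they cancel against the left. For
    \<open>n = 1\<close> the remaining interval is empty.\<close>
  moreover have "{1..n} = insert 1 {2..n}" if "n \<ge> 1" for n :: nat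
    using that by auto
  ultimately have "proots ?P = image_mset (\<lambda>t. 3 + 2 * lam1 t) (mset_set {2..n1}) +
      image_mset (\<lambda>t. 3 + 2 * lam2 t) (mset_set {2..n2}) + {# ?e1, ?e2 #}"
    using assms(3,6) by (simp add: lam[unfolded One_nat_def] add_mset_commute)
  then show ?thesis by (simp add: eigenvalue_mset_def s_def d_def)
qed

end
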